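(* Let $V$ be a finite set. Let $(K_t)_{t\ge1}$ be a sequence of irreducible aperiodic Markov transition operators on $V$ and $(\pi_t)_{t\ge1}$ a sequence of positive measures such that $\{(K_t,\pi_t)\}_{t\ge1}$ is a finite non-decreasing environment. Let $Q_t=K_t^*K_t$, where $K_t^*$ is the adjoint of $K_t$ on $\ell^2(\tilde\pi_t)$. Let $T\ge1$ and $C,D>0$. Assume that for all $t\ge1$ the pair $(Q_t,\tilde\pi_t)$ satisfies the $\mathcal N(C,D,T)$ Nash inequality, and that $\pi_1(V)\ge1$. Then for all integers $0\le r\le t\le T$, $$\left\|K_{r,t}-\tilde\pi_r(K_{r,t}\,\cdot)\right\|_{\ell^1(\tilde\pi_t)\to\ell^2(\tilde\pi_r)}\le\left(\frac{C\,2^{1/D}(1+1/T)(1+\lceil4D\rceil)}{t-r+1}\right)^D\frac{\pi_t(V)}{\sqrt{\pi_r(V)}},$$ and $$\left\|K_{r,t}-\tilde\pi_r(K_{r,t}\,\cdot)\right\|_{\ell^2(\tilde\pi_t)\to\ell^\infty(\tilde\pi_r)}\le2\left(\frac{4C\,2^{1/D}(1+1/T)(1+\lceil4D\rceil)}{t-r+1}\right)^D\sqrt{\pi_t(V)}.$$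
   Context: A Markov transition operator $K$ on $V$ is a map $K:V\times V\to[0,1]$ with $\sum_y K(x,y)=1$ for all $x$; it acts on functions by $(Kf)(x)=\sum_y K(x,y)f(y)$ and on measures by $(\mu K)(y)=\sum_x\mu(x)K(x,y)$. For $0\le r<t$, $K_{r,t}=K_{r+1}\cdots K_t$, and $K_{t,t}=I$; by convention $\pi_0:=\pi_1$. The operator $K_{r,t}-\tilde\pi_r(K_{r,t}\,\cdot)$ is $f\mapsto K_{r,t}f-\tilde\pi_r(K_{r,t}f)$. Finite non-decreasing environment: the $\pi_t$ are positive measures ($\pi_t(x)>0$ for all $x$) with, for all $t\ge1$: $\pi_tK_t=\pi_t$; $\pi_t(V)<+\infty$; $\pi_{t+1}(x)\ge\pi_t(x)$ for all $x\in V$. For a finite measure $\pi$, $\tilde\pi:=\pi/\pi(V)$ and $\tilde\pi(f)=\sum_xf(x)\tilde\pi(x)$. $\|f\|_{\ell^p(\tilde\pi)}=(\sum_x|f(x)|^p\tilde\pi(x))^{1/p}$, $\|f\|_{\ell^\infty}=\sup_x|f(x)|$. Dirichlet form: $\mathcal E_{Q,\tilde\pi}(f,f)=\langle(I-Q)f,f\rangle_{\tilde\pi}=\frac12\sum_{x,y}(f(x)-f(y))^2\tilde\pi(x)Q(x,y)$. Nash inequality: $(Q,\tilde\pi)$ satisfies the $\mathcal N(C,D,T)$ Nash inequality if for all $f:V\to\mathbb R$, $$\|f\|_{\ell^2(\tilde\pi)}^{2+1/D}\le C\left(\mathcal E_{Q,\tilde\pi}(f,f)+\frac1T\|f\|^2_{\ell^2(\tilde\pi)}\right)\|f\|_{\ell^1(\tilde\pi)}^{1/D}.$$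 *)

theory Defs
  imports "HOL-Analysis.Analysis"
begin

text \<open>The finite set \<open>V\<close> is the type \<open>'v :: finite\<close>. Kernels are functions
  \<open>'v \<Rightarrow> 'v \<Rightarrow> real\<close>, operators are functions on \<open>'v \<Rightarrow> real\<close>, and a finite measure on \<open>V\<close> is
  given by its point masses \<open>'v \<Rightarrow> real\<close>.\<close>

definition markov_kernel :: "('v::finite \<Rightarrow> 'v \<Rightarrow> real) \<Rightarrow> bool" where
  "markov_kernel K \<longleftrightarrow>
     (\<forall>x y. 0 \<le> K x y \<and> K x y \<le> 1) \<and> (\<forall>x. (\<Sum>y\<in>UNIV. K x y) = 1)"

definition kernel_op :: "('v::finite \<Rightarrow> 'v \<Rightarrow> real) \<Rightarrow> ('v \<Rightarrow> real) \<Rightarrow> 'v \<Rightarrow> real" where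
  "kernel_op K f x = (\<Sum>y\<in>UNIV. K x y * f y)"

definition measure_act :: "('v::finite \<Rightarrow> real) \<Rightarrow> ('v \<Rightarrow> 'v \<Rightarrow> real) \<Rightarrow> 'v \<Rightarrow> real" where
  "measure_act \<mu> K y = (\<Sum>x\<in>UNIV. \<mu> x * K x y)"

primrec kernel_power :: "('v::finite \<Rightarrow> 'v \<Rightarrow> real) \<Rightarrow> nat \<Rightarrow> 'v \<Rightarrow> 'v \<Rightarrow> real" where
  "kernel_power K 0 x y = (if x = y then 1 else 0)"
| "kernel_power K (Suc n) x y = (\<Sum>z\<in>UNIV. K x z * kernel_power K n z y)"

definition irreducible_kernel :: "('v::finite \<Rightarrow> 'v \<Rightarrow> real) \<Rightarrow> bool" where
  "irreducible_kernel K \<longleftrightarrow> (\<forall>x y. \<exists>n. kernel_power K n x y > 0)"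

definition aperiodic_kernel :: "('v::finite \<Rightarrow> 'v \<Rightarrow> real) \<Rightarrow> bool" where
  "aperiodic_kernel K \<longleftrightarrow> (\<forall>x. Gcd {n. n \<ge> 1 \<and> kernel_power K n x x > 0} = 1)"

text \<open>\<open>kernel_evolution K r t\<close> is \<open>K\<^sub>r\<^sub>,\<^sub>t = K\<^sub>r\<^sub>+\<^sub>1 \<cdots> K\<^sub>t\<close>, the identity for \<open>r = t\<close>.\<close>

definition kernel_evolution ::
    "(nat \<Rightarrow> 'v::finite \<Rightarrow> 'v \<Rightarrow> real) \<Rightarrow> nat \<Rightarrow> nat \<Rightarrow> ('v \<Rightarrow> real) \<Rightarrow> 'v \<Rightarrow> real" where
  "kernel_evolution K r t = foldr (\<circ>) (map (\<lambda>s. kernel_op (K s)) [Suc r..<Suc t]) id"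

definition mass :: "('v::finite \<Rightarrow> real) \<Rightarrow> real" where
  "mass \<mu> = (\<Sum>x\<in>UNIV. \<mu> x)"

definition normalized :: "('v::finite \<Rightarrow> real) \<Rightarrow> 'v \<Rightarrow> real" where
  "normalized \<mu> x = \<mu> x / mass \<mu>"

definition mean :: "('v::finite \<Rightarrow> real) \<Rightarrow> ('v \<Rightarrow> real) \<Rightarrow> real" where
  "mean \<mu> f = (\<Sum>x\<in>UNIV. f x * \<mu> x)"

text \<open>Finiteness of \<open>\<pi>\<^sub>t(V)\<close> needs no clause here: the point masses are real and \<open>V\<close> is finite.\<close>

definition finite_nondecreasing_environment ::
    "(nat \<Rightarrow> 'v::finite \<Rightarrow> 'v \<Rightarrow> real) \<Rightarrow> (nat \<Rightarrow> 'v \<Rightarrow> real) \<Rightarrow> bool" where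
  "finite_nondecreasing_environment K \<pi> \<longleftrightarrow>
     (\<forall>t\<ge>1. (\<forall>x. \<pi> t x > 0) \<and> measure_act (\<pi> t) (K t) = \<pi> t \<and> (\<forall>x. \<pi> (t + 1) x \<ge> \<pi> t x))"

definition ell_norm :: "real \<Rightarrow> ('v::finite \<Rightarrow> real) \<Rightarrow> ('v \<Rightarrow> real) \<Rightarrow> real" where
  "ell_norm p \<mu> f = (\<Sum>x\<in>UNIV. \<bar>f x\<bar> powr p * \<mu> x) powr (1 / p)"

definition ell_inf_norm :: "('v::finite \<Rightarrow> real) \<Rightarrow> real" where
  "ell_inf_norm f = (SUP x. \<bar>f x\<bar>)"

text \<open>The operator norm with respect to a norm \<open>M\<close> on the domain and \<open>N\<close> on the codomain.
  The supremum is taken in \<open>real\<close>; \<open>bdd_above_centred_2\<close> and \<open>bdd_above_centred_inf\<close> below show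
  that the sets in question are bounded.\<close>

definition op_norm ::
    "(('v \<Rightarrow> real) \<Rightarrow> real) \<Rightarrow> (('v \<Rightarrow> real) \<Rightarrow> real) \<Rightarrow> (('v \<Rightarrow> real) \<Rightarrow> 'v \<Rightarrow> real) \<Rightarrow> real" where
  "op_norm M N A = (SUP f\<in>{f. M f \<le> 1}. N (A f))"

definition centred_op ::
    "('v::finite \<Rightarrow> real) \<Rightarrow> (('v \<Rightarrow> real) \<Rightarrow> 'v \<Rightarrow> real) \<Rightarrow> ('v \<Rightarrow> real) \<Rightarrow> 'v \<Rightarrow> real" where
  "centred_op \<mu> A f x = A f x - mean \<mu> (A f)"

definition ell2_inner :: "('v::finite \<Rightarrow> real) \<Rightarrow> ('v \<Rightarrow> real) \<Rightarrow> ('v \<Rightarrow> real) \<Rightarrow> real" where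
  "ell2_inner \<mu> f g = (\<Sum>x\<in>UNIV. f x * g x * \<mu> x)"

definition ell2_adjoint ::
    "('v::finite \<Rightarrow> real) \<Rightarrow> (('v \<Rightarrow> real) \<Rightarrow> 'v \<Rightarrow> real) \<Rightarrow> ('v \<Rightarrow> real) \<Rightarrow> 'v \<Rightarrow> real" where
  "ell2_adjoint \<mu> A = (THE B. \<forall>f g. ell2_inner \<mu> (A f) g = ell2_inner \<mu> f (B g))"

definition dirichlet_form ::
    "(('v::finite \<Rightarrow> real) \<Rightarrow> 'v \<Rightarrow> real) \<Rightarrow> ('v \<Rightarrow> real) \<Rightarrow> ('v \<Rightarrow> real) \<Rightarrow> real" where
  "dirichlet_form Q \<mu> f = ell2_inner \<mu> (\<lambda>x. f x - Q f x) f"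

definition nash_inequality ::
    "real \<Rightarrow> real \<Rightarrow> real \<Rightarrow> (('v::finite \<Rightarrow> real) \<Rightarrow> 'v \<Rightarrow> real) \<Rightarrow> ('v \<Rightarrow> real) \<Rightarrow> bool" where
  "nash_inequality C D T Q \<mu> \<longleftrightarrow>
     (\<forall>f. ell_norm 2 \<mu> f powr (2 + 1 / D)
          \<le> C * (dirichlet_form Q \<mu> f + 1 / T * (ell_norm 2 \<mu> f)\<^sup>2) * ell_norm 1 \<mu> f powr (1 / D))"


lemma ell2_adjoint_kernel_op:
  fixes \<mu> :: "'v::finite \<Rightarrow> real"
  assumes pos: "\<And>x. \<mu> x > 0"
  shows "ell2_adjoint \<mu> (kernel_op K) = kernel_op (\<lambda>x y. \<mu> y * K y x / \<mu> x)"
    (is "_ = ?B")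
  unfolding ell2_adjoint_def
proof (rule the_equality)
  have nz: "\<mu> x \<noteq> 0" for x using pos[of x] by simp
  show ex: "\<forall>f g. ell2_inner \<mu> (kernel_op K f) g = ell2_inner \<mu> f (?B g)"
  proof (intro allI)
    fix f g
    have "ell2_inner \<mu> (kernel_op K f) g = (\<Sum>x\<in>UNIV. \<Sum>y\<in>UNIV. K x y * f y * g x * \<mu> x)"
      by (simp add: ell2_inner_def kernel_op_def sum_distrib_right)
    also have "\<dots> = (\<Sum>y\<in>UNIV. \<Sum>x\<in>UNIV. K x y * f y * g x * \<mu> x)"
      by (rule sum.swap)
    also have "\<dots> = ell2_inner \<mu> f (?B g)"
      by (simp add: ell2_inner_def kernel_op_def sum_distrib_right sum_distrib_left mult_ac nz)
    finally show "ell2_inner \<mu> (kernel_op K f) g = ell2_inner \<mu> f (?B g)" .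
  qed
  fix B assume B: "\<forall>f g. ell2_inner \<mu> (kernel_op K f) g = ell2_inner \<mu> f (B g)"
  show "B = ?B"
  proof (intro ext)
    fix g and x :: 'v
    let ?d = "\<lambda>y. if y = x then 1 else 0 :: real"
    have d: "ell2_inner \<mu> ?d h = h x * \<mu> x" for h
    proof -
      have "ell2_inner \<mu> ?d h = (\<Sum>y\<in>UNIV. if y = x then h y * \<mu> y else 0)"
        unfolding ell2_inner_def by (rule sum.cong) auto
      then show ?thesis by simp
    qed
    have "ell2_inner \<mu> ?d (B g) = ell2_inner \<mu> ?d (?B g)" using B ex by metis
    then show "B g x = ?B g x" using nz[of x] by (simp add: d)
  qed
qed

lemma dirichlet_form_kernel_op:
  fixes \<mu> :: "'v::finite \<Rightarrow> real"
  assumes Q: "markov_kernel Q" and inv: "measure_act \<mu> Q = \<mu>"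
  shows "dirichlet_form (kernel_op Q) \<mu> f
           = 1 / 2 * (\<Sum>x\<in>UNIV. \<Sum>y\<in>UNIV. (f x - f y)\<^sup>2 * \<mu> x * Q x y)"
proof -
  have row: "(\<Sum>y\<in>UNIV. Q x y) = 1" for x using Q by (simp add: markov_kernel_def)
  have col: "(\<Sum>x\<in>UNIV. \<mu> x * Q x y) = \<mu> y" for y
    using fun_cong[OF inv, of y] by (simp add: measure_act_def)
  let ?S = "\<Sum>x\<in>UNIV. (f x)\<^sup>2 * \<mu> x"
  let ?P = "\<Sum>x\<in>UNIV. \<Sum>y\<in>UNIV. f x * f y * \<mu> x * Q x y"
  have a: "(\<Sum>x\<in>UNIV. \<Sum>y\<in>UNIV. (f x)\<^sup>2 * \<mu> x * Q x y) = ?S"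
    by (simp add: sum_distrib_left[symmetric] row)
  have "(\<Sum>x\<in>UNIV. \<Sum>y\<in>UNIV. (f y)\<^sup>2 * \<mu> x * Q x y)
      = (\<Sum>y\<in>UNIV. \<Sum>x\<in>UNIV. (f y)\<^sup>2 * (\<mu> x * Q x y))"
    by (subst sum.swap) (simp add: mult_ac)
  also have "\<dots> = ?S" by (simp add: sum_distrib_left[symmetric] col)
  finally have b: "(\<Sum>x\<in>UNIV. \<Sum>y\<in>UNIV. (f y)\<^sup>2 * \<mu> x * Q x y) = ?S" .
  have "(\<Sum>x\<in>UNIV. \<Sum>y\<in>UNIV. (f x - f y)\<^sup>2 * \<mu> x * Q x y)
      = (\<Sum>x\<in>UNIV. \<Sum>y\<in>UNIV. (f x)\<^sup>2 * \<mu> x * Q x y + (f y)\<^sup>2 * \<mu> x * Q x y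
           - 2 * (f x * f y * \<mu> x * Q x y))"
    by (intro sum.cong refl) (simp add: power2_eq_square algebra_simps)
  also have "\<dots> = 2 * ?S - 2 * ?P"
    by (simp add: sum.distrib sum_subtractf a b sum_distrib_left)
  finally have "1 / 2 * (\<Sum>x\<in>UNIV. \<Sum>y\<in>UNIV. (f x - f y)\<^sup>2 * \<mu> x * Q x y) = ?S - ?P" by simp
  moreover have "dirichlet_form (kernel_op Q) \<mu> f = ?S - ?P"
  proof -
    have "dirichlet_form (kernel_op Q) \<mu> f
        = (\<Sum>x\<in>UNIV. (f x)\<^sup>2 * \<mu> x - (\<Sum>y\<in>UNIV. f x * f y * \<mu> x * Q x y))"
      unfolding dirichlet_form_def ell2_inner_def kernel_op_def
    proof (rule sum.cong[OF refl])
      fix x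
      have "(\<Sum>y\<in>UNIV. f x * f y * \<mu> x * Q x y) = f x * \<mu> x * (\<Sum>y\<in>UNIV. Q x y * f y)"
        unfolding sum_distrib_left by (rule sum.cong) (simp_all add: mult_ac)
      then show "(f x - (\<Sum>y\<in>UNIV. Q x y * f y)) * f x * \<mu> x
          = (f x)\<^sup>2 * \<mu> x - (\<Sum>y\<in>UNIV. f x * f y * \<mu> x * Q x y)"
        by (simp add: power2_eq_square algebra_simps)
    qed
    then show ?thesis by (simp add: sum_subtractf)
  qed
  ultimately show ?thesis by simp
qed

lemma kernel_op_abs_le:
  assumes "markov_kernel K" "\<And>x. \<bar>f x\<bar> \<le> B"
  shows "\<bar>kernel_op K f x\<bar> \<le> B"
proof -
  have "\<bar>kernel_op K f x\<bar> \<le> (\<Sum>y\<in>UNIV. \<bar>K x y * f y\<bar>)"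
    unfolding kernel_op_def by (rule sum_abs)
  also have "\<dots> \<le> (\<Sum>y\<in>UNIV. K x y * B)"
    using assms by (intro sum_mono) (auto simp: abs_mult markov_kernel_def intro!: mult_mono)
  also have "\<dots> = B" using assms(1) by (simp add: sum_distrib_right[symmetric] markov_kernel_def)
  finally show ?thesis .
qed

lemma kernel_evolution_abs_le:
  assumes K: "\<And>t. t \<ge> 1 \<Longrightarrow> markov_kernel (K t)" and f: "\<And>x. \<bar>f x\<bar> \<le> B"
  shows "\<bar>kernel_evolution K r t f x\<bar> \<le> B"
proof -
  have "\<forall>x. \<bar>foldr (\<circ>) (map (\<lambda>s. kernel_op (K s)) ss) id f x\<bar> \<le> B"
    if "\<forall>s\<in>set ss. s \<ge> 1" for ss
    using that by (induction ss) (auto simp: f intro!: kernel_op_abs_le K)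
  then show ?thesis unfolding kernel_evolution_def by (simp del: upt_Suc)
qed

lemma normalized_pos:
  fixes \<mu> :: "'v::finite \<Rightarrow> real"
  assumes "\<And>x. \<mu> x > 0"
  shows "normalized \<mu> x > 0"
  using assms by (auto simp: normalized_def mass_def intro!: divide_pos_pos sum_pos)

lemma sum_normalized:
  fixes \<mu> :: "'v::finite \<Rightarrow> real"
  assumes "\<And>x. \<mu> x > 0"
  shows "(\<Sum>x\<in>UNIV. normalized \<mu> x) = 1"
proof -
  have "mass \<mu> > 0" unfolding mass_def using assms by (intro sum_pos) auto
  then show ?thesis by (simp add: normalized_def sum_divide_distrib[symmetric] mass_def[symmetric])
qed

lemma ell_norm_unit_ball_bounded:
  fixes \<mu> :: "'v::finite \<Rightarrow> real"
  assumes pos: "\<And>x. \<mu> x > 0" and p: "p > 0"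
  shows "\<exists>B. \<forall>f x. ell_norm p \<mu> f \<le> 1 \<longrightarrow> \<bar>f x\<bar> \<le> B"
proof -
  let ?B = "\<Sum>y\<in>UNIV. (1 / \<mu> y) powr (1 / p)"
  have "\<bar>f x\<bar> \<le> ?B" if f: "ell_norm p \<mu> f \<le> 1" for f x
  proof -
    let ?S = "\<Sum>x\<in>UNIV. \<bar>f x\<bar> powr p * \<mu> x"
    have S0: "?S \<ge> 0" using pos by (intro sum_nonneg) (simp add: less_imp_le)
    have "?S = (?S powr (1 / p)) powr p" using p S0 by (simp add: powr_powr)
    also have "\<dots> \<le> 1" using f p by (intro powr_le1) (auto simp: ell_norm_def)
    finally have "?S \<le> 1" .
    moreover have "\<bar>f x\<bar> powr p * \<mu> x \<le> ?S"
      using pos by (intro member_le_sum) (auto simp: less_imp_le)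
    ultimately have "\<bar>f x\<bar> powr p \<le> 1 / \<mu> x" using pos[of x] by (simp add: field_simps)
    then have "(\<bar>f x\<bar> powr p) powr (1 / p) \<le> (1 / \<mu> x) powr (1 / p)"
      using p by (intro powr_mono2) auto
    then have "\<bar>f x\<bar> \<le> (1 / \<mu> x) powr (1 / p)" using p by (simp add: powr_powr)
    also have "\<dots> \<le> ?B" by (intro member_le_sum) auto
    finally show ?thesis .
  qed
  then show ?thesis by blast
qed

lemma centred_op_evolution_bounded:
  fixes K :: "nat \<Rightarrow> 'v::finite \<Rightarrow> 'v \<Rightarrow> real"
  assumes K: "\<And>t. t \<ge> 1 \<Longrightarrow> markov_kernel (K t)"
    and pos: "\<And>x. \<mu> x > 0" "\<And>x. \<nu> x > 0" and p: "p > 0"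
  shows "\<exists>B. \<forall>f x. ell_norm p (normalized \<mu>) f \<le> 1 \<longrightarrow>
      \<bar>centred_op (normalized \<nu>) (kernel_evolution K r t) f x\<bar> \<le> B"
proof -
  obtain B where B: "\<And>f x. ell_norm p (normalized \<mu>) f \<le> 1 \<Longrightarrow> \<bar>f x\<bar> \<le> B"
    using ell_norm_unit_ball_bounded[of "normalized \<mu>" p] normalized_pos[of \<mu>] pos(1) p by blast
  have "\<bar>centred_op (normalized \<nu>) (kernel_evolution K r t) f x\<bar> \<le> 2 * B"
    if f: "ell_norm p (normalized \<mu>) f \<le> 1" for f x
  proof -
    let ?g = "kernel_evolution K r t f"
    have g: "\<bar>?g y\<bar> \<le> B" for y by (rule kernel_evolution_abs_le[OF K B[OF f]])
    have "\<bar>mean (normalized \<nu>) ?g\<bar> \<le> (\<Sum>y\<in>UNIV. \<bar>?g y * normalized \<nu> y\<bar>)"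
      unfolding mean_def by (rule sum_abs)
    also have "\<dots> \<le> (\<Sum>y\<in>UNIV. B * normalized \<nu> y)"
      using g normalized_pos[of \<nu>] pos(2)
      by (intro sum_mono) (auto simp: abs_mult less_imp_le intro!: mult_right_mono)
    also have "\<dots> = B" using sum_normalized[of \<nu>] pos(2) by (simp add: sum_distrib_left[symmetric])
    finally show ?thesis using g[of x] unfolding centred_op_def by linarith
  qed
  then show ?thesis by blast
qed

lemma bdd_above_centred_2:
  fixes K :: "nat \<Rightarrow> 'v::finite \<Rightarrow> 'v \<Rightarrow> real"
  assumes K: "\<And>t. t \<ge> 1 \<Longrightarrow> markov_kernel (K t)"
    and pos: "\<And>x. \<mu> x > 0" "\<And>x. \<nu> x > 0" and p: "p > 0"
  shows "bdd_above ((\<lambda>f. ell_norm 2 (normalized \<nu>)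
           (centred_op (normalized \<nu>) (kernel_evolution K r t) f)) ` {f. ell_norm p (normalized \<mu>) f \<le> 1})"
proof -
  obtain B where B: "\<And>f x. ell_norm p (normalized \<mu>) f \<le> 1 \<Longrightarrow>
      \<bar>centred_op (normalized \<nu>) (kernel_evolution K r t) f x\<bar> \<le> B"
    using centred_op_evolution_bounded[of K \<mu> \<nu> p r t] assms by blast
  show ?thesis
  proof (rule bdd_aboveI2[where M = "(\<Sum>x\<in>UNIV. B powr 2 * normalized \<nu> x) powr (1 / 2)"])
    fix f assume "f \<in> {f. ell_norm p (normalized \<mu>) f \<le> 1}"
    then have f: "\<bar>centred_op (normalized \<nu>) (kernel_evolution K r t) f x\<bar> \<le> B" for x
      using B by simp
    have nn: "normalized \<nu> x \<ge> 0" for x using normalized_pos[of \<nu> x] pos(2) by (simp add: less_imp_le)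
    show "ell_norm 2 (normalized \<nu>) (centred_op (normalized \<nu>) (kernel_evolution K r t) f)
        \<le> (\<Sum>x\<in>UNIV. B powr 2 * normalized \<nu> x) powr (1 / 2)"
      unfolding ell_norm_def
      by (intro powr_mono2 sum_mono sum_nonneg mult_right_mono mult_nonneg_nonneg f nn) simp_all
  qed
qed

lemma bdd_above_centred_inf:
  fixes K :: "nat \<Rightarrow> 'v::finite \<Rightarrow> 'v \<Rightarrow> real"
  assumes K: "\<And>t. t \<ge> 1 \<Longrightarrow> markov_kernel (K t)"
    and pos: "\<And>x. \<mu> x > 0" "\<And>x. \<nu> x > 0" and p: "p > 0"
  shows "bdd_above ((\<lambda>f. ell_inf_norm
           (centred_op (normalized \<nu>) (kernel_evolution K r t) f)) ` {f. ell_norm p (normalized \<mu>) f \<le> 1})"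
proof -
  obtain B where B: "\<And>f x. ell_norm p (normalized \<mu>) f \<le> 1 \<Longrightarrow>
      \<bar>centred_op (normalized \<nu>) (kernel_evolution K r t) f x\<bar> \<le> B"
    using centred_op_evolution_bounded[of K \<mu> \<nu> p r t] assms by blast
  show ?thesis
    unfolding ell_inf_norm_def
    by (rule bdd_aboveI2[where M = B]) (auto intro!: cSUP_least B)
qed

end

theory Submission
  imports Defs
begin

text \<open>Since \<open>\<langle>(I - K\<^sub>t\<^sup>*K\<^sub>t)f, f\<rangle> = \<parallel>f\<parallel>\<^sup>2 - \<parallel>K\<^sub>tf\<parallel>\<^sup>2\<close> and the measures increase with time, the Nash
  inequality for the unnormalized measures becomes the recursive inequality
  \<open>v\<^sub>n powr (1 + 1 / (2 D)) \<le> C (v\<^sub>n - v\<^sub>n\<^sub>+\<^sub>1 + v\<^sub>n / T)\<close> for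
  \<open>v\<^sub>n = \<parallel>K\<^sub>t\<^sub>-\<^sub>n\<^sub>,\<^sub>t f\<parallel>\<^sup>2\<close> in \<open>\<ell>\<^sup>2(\<pi>\<^sub>t\<^sub>-\<^sub>n)\<close>, where \<open>\<parallel>f\<parallel>\<^sub>1 \<le> 1\<close> in \<open>\<ell>\<^sup>1(\<pi>\<^sub>t)\<close>. It forces
  \<open>v\<^sub>n\<close> to decay like \<open>n powr (- 2 D)\<close> up to time \<open>T\<close>, which is the bound from \<open>\<ell>\<^sup>1\<close> to \<open>\<ell>\<^sup>2\<close>.
  No Nash inequality is assumed for \<open>K\<^sub>tK\<^sub>t\<^sup>*\<close>, so the bound from \<open>\<ell>\<^sup>2\<close> to \<open>\<ell>\<^sup>\<infinity>\<close> is not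
  obtained by duality but from the first one, by extrapolating through \<open>\<ell>\<^sup>4\<close> with Jensen's
  inequality \<open>(Kf)\<^sup>2 \<le> K(f\<^sup>2)\<close>.\<close>

section \<open>Markov kernels acting on functions\<close>

lemma kernel_op_cmult: "kernel_op P (\<lambda>y. c * f y) x = c * kernel_op P f x"
  unfolding kernel_op_def sum_distrib_left by (rule sum.cong) auto

lemma kernel_op_abs:
  assumes "markov_kernel P"
  shows "\<bar>kernel_op P f x\<bar> \<le> kernel_op P (\<lambda>y. \<bar>f y\<bar>) x"
proof -
  have "\<bar>kernel_op P f x\<bar> \<le> (\<Sum>y\<in>UNIV. \<bar>P x y * f y\<bar>)"
    unfolding kernel_op_def by (rule sum_abs)
  also have "\<dots> = kernel_op P (\<lambda>y. \<bar>f y\<bar>) x"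
    using assms by (simp add: kernel_op_def abs_mult markov_kernel_def)
  finally show ?thesis .
qed

text \<open>The variance of \<open>f\<close> under the probability \<open>P x\<close> is
  nonnegative.\<close>

lemma kernel_op_square_le:
  assumes P: "markov_kernel P"
  shows "(kernel_op P f x)\<^sup>2 \<le> kernel_op P (\<lambda>y. (f y)\<^sup>2) x"
proof -
  define m where "m = kernel_op P f x"
  have row: "(\<Sum>y\<in>UNIV. P x y) = 1" using P by (simp add: markov_kernel_def)
  have "0 \<le> (\<Sum>y\<in>UNIV. P x y * (f y - m)\<^sup>2)"
    using P by (intro sum_nonneg mult_nonneg_nonneg) (auto simp: markov_kernel_def)
  also have "\<dots> = (\<Sum>y\<in>UNIV. P x y * (f y)\<^sup>2 - 2 * m * (P x y * f y) + m\<^sup>2 * P x y)"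
    by (intro sum.cong refl) (simp add: power2_eq_square algebra_simps)
  also have "\<dots> = kernel_op P (\<lambda>y. (f y)\<^sup>2) x - 2 * m * m + m\<^sup>2"
    by (simp add: sum.distrib sum_subtractf sum_distrib_left[symmetric] row kernel_op_def m_def)
  finally show ?thesis by (simp add: m_def power2_eq_square)
qed

text \<open>This lets Jensen's inequality be applied to a whole block of steps, seen as a single
  kernel.\<close>

lemma kernel_op_comp_markov:
  fixes P Q :: "'v::finite \<Rightarrow> 'v \<Rightarrow> real"
  assumes P: "markov_kernel P" and Q: "markov_kernel Q"
  shows "\<exists>R. markov_kernel R \<and> kernel_op P \<circ> kernel_op Q = kernel_op R"
proof (intro exI conjI)
  let ?R = "\<lambda>x y. \<Sum>z\<in>UNIV. P x z * Q z y"
  have nn: "?R x y \<ge> 0" for x y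
    using P Q by (intro sum_nonneg mult_nonneg_nonneg) (auto simp: markov_kernel_def)
  have row: "(\<Sum>y\<in>UNIV. ?R x y) = 1" for x
    by (subst sum.swap) (use P Q in \<open>simp add: sum_distrib_left[symmetric] markov_kernel_def\<close>)
  have "?R x y \<le> 1" for x y
    using member_le_sum[of y UNIV "?R x"] nn row by auto
  with nn row show "markov_kernel ?R" by (simp add: markov_kernel_def)
  show "kernel_op P \<circ> kernel_op Q = kernel_op ?R"
  proof (intro ext)
    fix f x
    have "(kernel_op P \<circ> kernel_op Q) f x = (\<Sum>z\<in>UNIV. \<Sum>y\<in>UNIV. P x z * Q z y * f y)"
      by (simp add: kernel_op_def sum_distrib_left mult_ac)
    also have "\<dots> = kernel_op ?R f x"
      by (subst sum.swap) (simp add: kernel_op_def sum_distrib_right)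
    finally show "(kernel_op P \<circ> kernel_op Q) f x = kernel_op ?R f x" .
  qed
qed

section \<open>Means, and contraction under an invariant measure\<close>

lemma mean_mono:
  assumes "\<And>x. \<mu> x \<ge> 0" "\<And>x. f x \<le> g x"
  shows "mean \<mu> f \<le> mean \<mu> g"
  using assms unfolding mean_def by (intro sum_mono mult_right_mono) auto

lemma mean_mono_measure:
  assumes "\<And>x. \<mu> x \<le> \<nu> x" "\<And>x. f x \<ge> 0"
  shows "mean \<mu> f \<le> mean \<nu> f"
  using assms unfolding mean_def by (intro sum_mono mult_left_mono) auto

lemma mean_nonneg:
  assumes "\<And>x. \<mu> x \<ge> 0" "\<And>x. f x \<ge> 0"
  shows "mean \<mu> f \<ge> 0"
  using assms unfolding mean_def by (intro sum_nonneg mult_nonneg_nonneg) auto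

lemma mean_cmult: "mean \<mu> (\<lambda>x. c * f x) = c * mean \<mu> f"
  unfolding mean_def sum_distrib_left by (rule sum.cong) auto

lemma mean_normalized: "mean (normalized \<mu>) f = mean \<mu> f / mass \<mu>"
  by (simp add: mean_def normalized_def sum_divide_distrib)

lemma mass_pos:
  fixes \<mu> :: "'v::finite \<Rightarrow> real"
  assumes "\<And>x. \<mu> x > 0"
  shows "mass \<mu> > 0"
  unfolding mass_def using assms by (intro sum_pos) auto

lemma mean_kernel_op:
  assumes "measure_act \<mu> K = \<mu>"
  shows "mean \<mu> (kernel_op K f) = mean \<mu> f"
proof -
  have "mean \<mu> (kernel_op K f) = (\<Sum>x\<in>UNIV. \<Sum>y\<in>UNIV. K x y * f y * \<mu> x)"
    by (simp add: mean_def kernel_op_def sum_distrib_right)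
  also have "\<dots> = mean (measure_act \<mu> K) f"
    by (subst sum.swap) (simp add: mean_def measure_act_def sum_distrib_left mult_ac)
  finally show ?thesis using assms by simp
qed

lemma mean_abs_kernel_op_le:
  assumes "markov_kernel K" "measure_act \<mu> K = \<mu>" "\<And>x. \<mu> x \<ge> 0"
  shows "mean \<mu> (\<lambda>x. \<bar>kernel_op K f x\<bar>) \<le> mean \<mu> (\<lambda>x. \<bar>f x\<bar>)"
  using mean_mono[of \<mu> "\<lambda>x. \<bar>kernel_op K f x\<bar>" "kernel_op K (\<lambda>x. \<bar>f x\<bar>)"] assms(3)
    kernel_op_abs[OF assms(1)]
  by (simp add: mean_kernel_op[OF assms(2)])

text \<open>Jensen's inequality holds pointwise; averaging it over an invariant measure removes
  \<open>K\<close> on the right.\<close>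

lemma mean_square_kernel_op_le:
  assumes "markov_kernel K" "measure_act \<mu> K = \<mu>" "\<And>x. \<mu> x \<ge> 0"
  shows "mean \<mu> (\<lambda>x. (kernel_op K f x)\<^sup>2) \<le> mean \<mu> (\<lambda>x. (f x)\<^sup>2)"
  using mean_mono[of \<mu> "\<lambda>x. (kernel_op K f x)\<^sup>2" "kernel_op K (\<lambda>x. (f x)\<^sup>2)"] assms(3)
    kernel_op_square_le[OF assms(1)]
  by (simp add: mean_kernel_op[OF assms(2)])

section \<open>The Nash inequality for an unnormalized measure\<close>

lemma ell_norm_1: "(\<And>x. \<mu> x \<ge> 0) \<Longrightarrow> ell_norm 1 \<mu> f = mean \<mu> (\<lambda>x. \<bar>f x\<bar>)"
  unfolding ell_norm_def mean_def by (simp add: sum_nonneg)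

lemma ell_norm_2: "(\<And>x. \<mu> x \<ge> 0) \<Longrightarrow> ell_norm 2 \<mu> f = sqrt (mean \<mu> (\<lambda>x. (f x)\<^sup>2))"
  unfolding ell_norm_def mean_def by (simp add: sum_nonneg powr_half_sqrt)

text \<open>Inserting the explicit adjoint kernel and exchanging the sums moves the adjoint onto the
  other factor. The form is thus the energy lost in one step, which is what telescopes.\<close>

lemma dirichlet_form_adjoint_comp:
  fixes \<mu> :: "'v::finite \<Rightarrow> real"
  assumes pos: "\<And>x. \<mu> x > 0"
  shows "dirichlet_form (ell2_adjoint \<mu> (kernel_op K) \<circ> kernel_op K) \<mu> f
    = mean \<mu> (\<lambda>x. (f x)\<^sup>2) - mean \<mu> (\<lambda>x. (kernel_op K f x)\<^sup>2)"
proof -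
  let ?B = "ell2_adjoint \<mu> (kernel_op K)" and ?g = "kernel_op K f"
  have nz: "\<mu> x \<noteq> 0" for x using pos[of x] by simp
  have "(\<Sum>x\<in>UNIV. ?B ?g x * f x * \<mu> x) = (\<Sum>x\<in>UNIV. \<Sum>y\<in>UNIV. \<mu> y * K y x * ?g y * f x)"
    unfolding ell2_adjoint_kernel_op[OF pos]
    by (subst kernel_op_def) (simp add: nz sum_distrib_right)
  also have "\<dots> = mean \<mu> (\<lambda>y. ?g y * ?g y)"
    by (subst sum.swap) (simp add: mean_def kernel_op_def[of K f] sum_distrib_left sum_distrib_right mult_ac)
  finally show ?thesis
    by (simp add: dirichlet_form_def ell2_inner_def mean_def left_diff_distrib sum_subtractf
        power2_eq_square)
qed

text \<open>Passing from the normalized to the unnormalized measure multiplies the Nash constant by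
  \<open>\<mu>(V) powr (- 1 / (2 D))\<close>, which is at most 1.\<close>

lemma nash_inequality_unnormalized:
  fixes \<mu> :: "'v::finite \<Rightarrow> real"
  assumes pos: "\<And>x. \<mu> x > 0" and K: "markov_kernel K" and inv: "measure_act \<mu> K = \<mu>"
    and M: "mass \<mu> \<ge> 1" and C: "C > 0" and D: "D > 0" and T: "T > 0"
    and nash: "nash_inequality C D T
      (ell2_adjoint (normalized \<mu>) (kernel_op K) \<circ> kernel_op K) (normalized \<mu>)"
    and f: "mean \<mu> (\<lambda>x. \<bar>f x\<bar>) \<le> 1"
  shows "mean \<mu> (\<lambda>x. (f x)\<^sup>2) powr (1 + 1 / (2 * D))
    \<le> C * (mean \<mu> (\<lambda>x. (f x)\<^sup>2) - mean \<mu> (\<lambda>x. (kernel_op K f x)\<^sup>2) + mean \<mu> (\<lambda>x. (f x)\<^sup>2) / T)"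
proof -
  define S where "S = mean \<mu> (\<lambda>x. (f x)\<^sup>2)"
  define S' where "S' = mean \<mu> (\<lambda>x. (kernel_op K f x)\<^sup>2)"
  define L where "L = mean \<mu> (\<lambda>x. \<bar>f x\<bar>)"
  define m where "m = mass \<mu>"
  define X where "X = S - S' + S / T"
  have m: "m \<ge> 1" using M by (simp add: m_def)
  have nn: "normalized \<mu> x \<ge> 0" for x using normalized_pos[of \<mu> x] pos by (simp add: less_imp_le)
  have mu: "\<mu> x \<ge> 0" for x using pos by (simp add: less_imp_le)
  have S: "S \<ge> 0" and L: "0 \<le> L" "L \<le> 1"
    unfolding S_def L_def using f by (auto intro!: mean_nonneg mu)
  \<comment> \<open>The sign of \<open>X\<close> is what permits replacing first \<open>L\<close>
    and then the remaining power of \<open>m\<close> by 1 in the factors of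
    \<open>X\<close>.\<close>
  have X: "X \<ge> 0"
    using mean_square_kernel_op_le[OF K inv mu, of f] S T by (simp add: X_def S_def S'_def)
  have "(S / m) powr (1 + 1 / (2 * D)) = sqrt (S / m) powr (2 + 1 / D)"
    using S m D by (simp add: powr_half_sqrt[symmetric] powr_powr field_simps)
  also have "\<dots> \<le> C * ((S / m - S' / m) + 1 / T * (sqrt (S / m))\<^sup>2) * (L / m) powr (1 / D)"
    using nash[unfolded nash_inequality_def, rule_format, of f]
    by (simp add: ell_norm_1 ell_norm_2 nn dirichlet_form_adjoint_comp normalized_pos pos
        mean_normalized S_def S'_def L_def m_def)
  also have "\<dots> = C * X / m * (L / m) powr (1 / D)"
    using S m by (simp add: X_def field_simps)
  also have "\<dots> \<le> C * X / m * (1 / m) powr (1 / D)"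
    using C X m L D by (intro mult_left_mono powr_mono2 divide_right_mono) auto
  finally have "(S / m) powr (1 + 1 / (2 * D)) * m powr (1 + 1 / (2 * D))
      \<le> C * X / m * (1 / m) powr (1 / D) * m powr (1 + 1 / (2 * D))"
    by (rule mult_right_mono) simp
  also have "\<dots> = C * X * m powr (- 1 / (2 * D))"
  proof -
    have "(1 / m) powr (1 / D) * m powr (1 + 1 / (2 * D)) = m powr (- (1 / D) + (1 + 1 / (2 * D)))"
      using m by (simp only: powr_add) (simp add: powr_minus_divide powr_divide)
    also have "- (1 / D) + (1 + 1 / (2 * D)) = 1 + - 1 / (2 * D)" using D by (simp add: field_simps)
    also have "m powr (1 + - 1 / (2 * D)) = m * m powr (- 1 / (2 * D))" using m by (subst powr_add) simp
    finally show ?thesis using m by (simp add: field_simps)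
  qed
  also have "\<dots> \<le> C * X * 1"
  proof (intro mult_left_mono)
    have "m powr (- 1 / (2 * D)) \<le> m powr 0" using m D by (intro powr_mono) auto
    then show "m powr (- 1 / (2 * D)) \<le> 1" using m by simp
  qed (use C X in auto)
  finally show ?thesis
    using S m by (simp add: powr_mult[symmetric] X_def S_def S'_def)
qed

section \<open>Evolution operators\<close>

lemma kernel_evolution_refl [simp]: "kernel_evolution K t t = id"
  by (simp add: kernel_evolution_def)

lemma kernel_evolution_compose:
  assumes "r \<le> s" "s \<le> t"
  shows "kernel_evolution K r t f = kernel_evolution K r s (kernel_evolution K s t f)"
proof -
  have fold: "foldr (\<circ>) fs g = foldr (\<circ>) fs id \<circ> g" for fs :: "('b \<Rightarrow> 'b) list" and g :: "'b \<Rightarrow> 'b"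
    by (induction fs) (auto simp: o_assoc)
  have "[Suc r..<Suc t] = [Suc r..<Suc s] @ [Suc s..<Suc t]"
    using assms upt_add_eq_append[of "Suc r" "Suc s" "t - s"] by (simp del: upt_Suc)
  then have "kernel_evolution K r t = kernel_evolution K r s \<circ> kernel_evolution K s t"
    unfolding kernel_evolution_def by (simp only: map_append foldr_append) (rule fold)
  then show ?thesis by simp
qed

lemma kernel_evolution_step:
  assumes "s < t"
  shows "kernel_evolution K s t f = kernel_op (K (Suc s)) (kernel_evolution K (Suc s) t f)"
  using assms kernel_evolution_compose[of s "Suc s" t K f] by (simp add: kernel_evolution_def[of K s "Suc s"])

lemma kernel_evolution_markov:
  fixes K :: "nat \<Rightarrow> 'v::finite \<Rightarrow> 'v \<Rightarrow> real"
  assumes K: "\<And>t. t \<ge> 1 \<Longrightarrow> markov_kernel (K t)" and "r \<le> t"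
  shows "\<exists>P. markov_kernel P \<and> kernel_evolution K r t = kernel_op P"
  using \<open>r \<le> t\<close>
proof (induction rule: inc_induct)
  case base
  have 1: "(\<Sum>y\<in>UNIV. (if x = y then 1 else 0::real) * f y) = f x" for x :: 'v and f
    by (subst sum.cong[OF refl, of _ _ "\<lambda>y. if x = y then f y else 0"]) auto
  show ?case
    by (intro exI[of _ "\<lambda>x y. if x = y then 1 else 0"] conjI ext)
      (auto simp: markov_kernel_def kernel_op_def 1)
next
  case (step n)
  then obtain P where P: "markov_kernel P" "kernel_evolution K (Suc n) t = kernel_op P" by blast
  obtain R where R: "markov_kernel R" "kernel_op (K (Suc n)) \<circ> kernel_op P = kernel_op R"
    using kernel_op_comp_markov[of "K (Suc n)" P] K[of "Suc n"] P(1) by auto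
  have "kernel_evolution K n t = kernel_op (K (Suc n)) \<circ> kernel_evolution K (Suc n) t"
    using step by (auto simp: kernel_evolution_step)
  then have "kernel_evolution K n t = kernel_op R" by (simp only: P R)
  with R(1) show ?case by blast
qed

section \<open>Decay of sequences satisfying the recursive Nash inequality\<close>

text \<open>After removing the factor \<open>(1 + 1 / T) ^ n \<le> exp 1\<close>, the normalized roots
  \<open>y\<^sub>n\<close> satisfy \<open>y\<^sub>n\<^sub>+\<^sub>1 \<le> y\<^sub>n exp (- y\<^sub>n / p) \<le> y\<^sub>n / (1 + y\<^sub>n / p)\<close>, so that \<open>1 / y\<^sub>n\<close>
  grows at least linearly.\<close>

lemma nash_sequence_decay:
  fixes v :: "nat \<Rightarrow> real" and C T p :: real
  assumes v: "\<And>n. v n \<ge> 0" and C: "C > 0" and p: "p > 0" and T: "T \<ge> 1" and N: "real N \<le> T"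
    and init: "v 0 powr (1 / p) \<le> C * (1 + 1 / T)"
    and rec: "\<And>n. n < N \<Longrightarrow> v n powr (1 + 1 / p) \<le> C * (v n - v (Suc n) + v n / T)"
  shows "v N \<le> 4 * (C * (1 + 1 / T) * (1 + real_of_int \<lceil>2 * p\<rceil>) / (real N + 1)) powr p"
proof -
  define q where "q = 1 + 1 / T"
  define c where "c = C * q"
  define z where "z n = v n / q ^ n" for n
  define y where "y n = z n powr (1 / p) / c" for n
  have q: "q \<ge> 1" "q > 0" and c: "c > 0" using T C by (auto simp: q_def c_def add_pos_nonneg)
  have z: "z n \<ge> 0" for n using v q by (simp add: z_def)
  have y: "y n \<ge> 0" for n using c by (simp add: y_def)
  have step: "y (Suc n) \<le> y n / (1 + y n / p)" if n: "n < N" for n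
  proof -
    have "v n powr (1 + 1 / p) = v n * v n powr (1 / p)"
      using v[of n] by (simp add: powr_add)
    then have "C * v (Suc n) \<le> C * q * v n - v n * v n powr (1 / p)"
      using rec[OF n] T by (simp add: q_def algebra_simps)
    then have "v (Suc n) \<le> q * v n - v n * v n powr (1 / p) / C"
      using C by (simp add: field_simps)
    also have "\<dots> = q * v n * (1 - v n powr (1 / p) / c)"
      using C q by (simp add: c_def right_diff_distrib)
    \<comment> \<open>Since \<open>q ^ n \<ge> 1\<close>, \<open>z n \<le> v n\<close>, and a
      smaller subtracted term weakens the bound.\<close>
    also have "\<dots> \<le> q * v n * (1 - y n)"
    proof -
      have "z n \<le> v n" unfolding z_def using v[of n] q one_le_power[of q n]
        by (simp add: divide_le_eq mult_le_cancel_left1)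
      then have "y n \<le> v n powr (1 / p) / c" unfolding y_def using z c p
        by (intro divide_right_mono powr_mono2) auto
      then show ?thesis using q v by (intro mult_left_mono) auto
    qed
    finally have "v (Suc n) / q ^ Suc n \<le> q * v n * (1 - y n) / q ^ Suc n"
      using q by (intro divide_right_mono) auto
    then have "z (Suc n) \<le> z n * (1 - y n)" using q by (simp add: z_def)
    \<comment> \<open>Unlike \<open>1 - y n\<close>, the factor \<open>exp (- y n)\<close> is always
      positive, so the root of order \<open>p\<close> can be taken and simply divides the exponent
      by \<open>p\<close>.\<close>
    also have "\<dots> \<le> z n * exp (- y n)"
      using exp_ge_add_one_self[of "- y n"] z by (intro mult_left_mono) auto
    finally have "z (Suc n) powr (1 / p) \<le> (z n * exp (- y n)) powr (1 / p)"
      using z p by (intro powr_mono2) auto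
    also have "\<dots> = z n powr (1 / p) * exp (- (y n / p))"
      using z by (simp add: powr_mult exp_powr_real)
    also have "\<dots> \<le> z n powr (1 / p) * (1 / (1 + y n / p))"
    proof (intro mult_left_mono)
      have "0 < 1 + y n / p" "1 + y n / p \<le> exp (y n / p)"
        using y[of n] p exp_ge_add_one_self[of "y n / p"] by (auto intro: add_pos_nonneg)
      then show "exp (- (y n / p)) \<le> 1 / (1 + y n / p)"
        by (simp add: exp_minus inverse_eq_divide frac_le)
    qed simp
    finally have "y (Suc n) \<le> z n powr (1 / p) * (1 / (1 + y n / p)) / c"
      unfolding y_def[of "Suc n"] using c by (intro divide_right_mono) auto
    also have "\<dots> = z n powr (1 / p) / c / (1 + y n / p)" by simp
    also have "z n powr (1 / p) / c = y n" by (simp add: y_def)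
    finally show ?thesis .
  qed
  \<comment> \<open>This is \<open>1 / y n \<ge> 1 + n / p\<close>, written without dividing by
    \<open>y n\<close>, which may vanish.\<close>
  have lin: "(1 + real n / p) * y n \<le> 1" if "n \<le> N" for n
    using that
  proof (induction n)
    case 0
    show ?case using init c by (simp add: y_def z_def c_def q_def)
  next
    case (Suc n)
    have pos: "0 < 1 + y n / p" using y[of n] p by (auto intro: add_pos_nonneg)
    have "(1 + real (Suc n) / p) * y (Suc n) \<le> (1 + real (Suc n) / p) * (y n / (1 + y n / p))"
      using Suc.prems p by (intro mult_left_mono step) auto
    also have "\<dots> = ((1 + real n / p) * y n + y n / p) / (1 + y n / p)"
      by (simp add: add_divide_distrib distrib_right)
    also have "\<dots> \<le> 1" using Suc pos by simp
    finally show ?case .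
  qed
  \<comment> \<open>At \<open>p = 2 * D\<close> the ceiling becomes the
    \<open>\<lceil>4 * D\<rceil>\<close> of the theorem. The estimate rests on
    \<open>L \<ge> 1\<close> and \<open>L \<ge> p\<close>.\<close>
  define L where "L = 1 + real_of_int \<lceil>2 * p\<rceil>"
  have L: "L \<ge> 1" "L \<ge> p" using p le_of_int_ceiling[of "2 * p"] unfolding L_def by linarith+
  have "y N \<le> L / (real N + 1)"
  proof -
    have "real N + 1 \<le> L * (1 + real N / p)"
    proof -
      have "real N \<le> L * (real N / p)" using L p by (simp add: field_simps mult_right_mono)
      then show ?thesis using L by (simp add: distrib_left)
    qed
    then have "(real N + 1) * y N \<le> L * (1 + real N / p) * y N"
      using y by (intro mult_right_mono) auto
    also have "\<dots> \<le> L * 1"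
      using lin[of N] L by (simp only: mult.assoc) (intro mult_left_mono, auto)
    finally show ?thesis by (simp add: field_simps)
  qed
  then have "z N powr (1 / p) \<le> c * L / (real N + 1)"
    using c by (simp add: y_def field_simps)
  then have "(z N powr (1 / p)) powr p \<le> (c * L / (real N + 1)) powr p"
    using p by (intro powr_mono2) auto
  then have zN: "z N \<le> (c * L / (real N + 1)) powr p"
    using z p by (simp add: powr_powr)
  \<comment> \<open>Here \<open>N \<le> T\<close> enters: undoing the rescaling costs at most
    \<open>exp 1\<close>. It is rounded up to 4, whose square root 2 later becomes
    \<open>2 powr (1 / D)\<close> inside the power.\<close>
  have "q ^ N \<le> exp (1 / T) ^ N"
    using q exp_ge_add_one_self[of "1 / T"] by (intro power_mono) (auto simp: q_def)
  also have "\<dots> = exp (real N / T)" by (simp add: exp_of_nat_mult[symmetric])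
  also have "\<dots> \<le> exp 1" using N T by simp
  also have "\<dots> \<le> 4" using exp_le by simp
  finally have "q ^ N * z N \<le> 4 * (c * L / (real N + 1)) powr p"
    using zN z by (intro mult_mono) auto
  then show ?thesis using q by (simp add: z_def c_def q_def L_def)
qed

section \<open>Bounds on the evolution in a non-decreasing environment\<close>

locale nash_environment =
  fixes K :: "nat \<Rightarrow> 'v::finite \<Rightarrow> 'v \<Rightarrow> real" and \<pi> :: "nat \<Rightarrow> 'v \<Rightarrow> real" and C D T :: real
  assumes markov: "\<And>t. t \<ge> 1 \<Longrightarrow> markov_kernel (K t)"
    and env: "finite_nondecreasing_environment K \<pi>"
    and pi_0: "\<pi> 0 = \<pi> 1"
    and T: "T \<ge> 1" and C: "C > 0" and D: "D > 0"
    and nash: "\<And>t. t \<ge> 1 \<Longrightarrow> nash_inequality C D T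
        (ell2_adjoint (normalized (\<pi> t)) (kernel_op (K t)) \<circ> kernel_op (K t)) (normalized (\<pi> t))"
    and mass_1: "mass (\<pi> 1) \<ge> 1"
begin

lemma pi_pos: "\<pi> t x > 0"
  using env pi_0 by (cases t) (auto simp: finite_nondecreasing_environment_def)

lemma pi_nonneg: "\<pi> t x \<ge> 0"
  using pi_pos by (simp add: less_imp_le)

lemma pi_invariant: "t \<ge> 1 \<Longrightarrow> measure_act (\<pi> t) (K t) = \<pi> t"
  using env by (auto simp: finite_nondecreasing_environment_def)

lemma pi_Suc: "\<pi> t x \<le> \<pi> (Suc t) x"
  using env pi_0 by (cases t) (auto simp: finite_nondecreasing_environment_def)

lemma mass_ge_1: "mass (\<pi> t) \<ge> 1"
proof (induction t)
  case 0
  then show ?case using mass_1 pi_0 by simp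
next
  case (Suc t)
  have "mass (\<pi> t) \<le> mass (\<pi> (Suc t))" unfolding mass_def by (intro sum_mono pi_Suc)
  with Suc show ?case by simp
qed

lemma nash_step:
  assumes "t \<ge> 1" "mean (\<pi> t) (\<lambda>x. \<bar>f x\<bar>) \<le> 1"
  shows "mean (\<pi> t) (\<lambda>x. (f x)\<^sup>2) powr (1 + 1 / (2 * D))
    \<le> C * (mean (\<pi> t) (\<lambda>x. (f x)\<^sup>2) - mean (\<pi> t) (\<lambda>x. (kernel_op (K t) f x)\<^sup>2)
            + mean (\<pi> t) (\<lambda>x. (f x)\<^sup>2) / T)"
  using assms nash_inequality_unnormalized[of "\<pi> t" "K t" C D T f]
    markov pi_pos pi_invariant mass_ge_1 C D T nash by simp

text \<open>Dropping the energy after the step from the Nash inequality leaves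
  \<open>S powr (1 + 1 / (2 * D)) \<le> C * (S + S / T)\<close>; dividing by \<open>S\<close> gives
  the start of the recursion.\<close>

lemma nash_initial:
  assumes f: "mean (\<pi> t) (\<lambda>x. \<bar>f x\<bar>) \<le> 1"
  shows "mean (\<pi> t) (\<lambda>x. (f x)\<^sup>2) powr (1 / (2 * D)) \<le> C * (1 + 1 / T)"
proof -
  define S where "S = mean (\<pi> t) (\<lambda>x. (f x)\<^sup>2)"
  \<comment> \<open>At time 0 the Nash inequality of time 1 serves, as both times carry the same
    measure.\<close>
  obtain s where s: "s \<ge> 1" "\<pi> s = \<pi> t" using pi_0 by (cases t) auto
  have "S \<ge> 0" unfolding S_def by (intro mean_nonneg pi_nonneg) simp
  show ?thesis
  proof (cases "S = 0")
    case True
    then show ?thesis using C T by (simp add: S_def[symmetric])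
  next
    case False
    with \<open>S \<ge> 0\<close> have S: "S > 0" by simp
    have S': "mean (\<pi> s) (\<lambda>x. (kernel_op (K s) f x)\<^sup>2) \<ge> 0"
      by (intro mean_nonneg pi_nonneg) simp
    have "S * S powr (1 / (2 * D)) = S powr (1 + 1 / (2 * D))"
      using S by (simp add: powr_add)
    also have "\<dots> \<le> C * (S - mean (\<pi> s) (\<lambda>x. (kernel_op (K s) f x)\<^sup>2) + S / T)"
      using nash_step[OF s(1), of f] f s(2) by (simp add: S_def)
    also have "\<dots> \<le> C * (S + S / T)" using C S' by (intro mult_left_mono) auto
    also have "\<dots> = S * (C * (1 + 1 / T))" by (simp add: algebra_simps)
    finally show ?thesis using S by (simp add: S_def)
  qed
qed

text \<open>The base of the stated bounds without \<open>2 powr (1 / D)\<close>, which appears in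
  the evolution bounds as a prefactor 2.\<close>

definition rate :: real where
  "rate = C * (1 + 1 / T) * (1 + real_of_int \<lceil>4 * D\<rceil>)"

lemma rate_pos: "rate > 0"
proof -
  have "0 \<le> \<lceil>4 * D\<rceil>" using D by linarith
  then show ?thesis unfolding rate_def using C T by (intro mult_pos_pos add_pos_nonneg) auto
qed

text \<open>Going back one step, the measure decreases and \<open>K (Suc s)\<close> contracts the
  norm for its own invariant measure. This keeps the normalization that \<open>nash_step\<close>
  requires.\<close>

lemma evolution_mean_abs_le:
  assumes "mean (\<pi> t) (\<lambda>x. \<bar>f x\<bar>) \<le> 1" "s \<le> t"
  shows "mean (\<pi> s) (\<lambda>x. \<bar>kernel_evolution K s t f x\<bar>) \<le> 1"
  using assms(2)
proof (induction rule: inc_induct)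
  case base
  then show ?case using assms by simp
next
  case (step s)
  let ?g = "kernel_evolution K (Suc s) t f"
  have "mean (\<pi> s) (\<lambda>x. \<bar>kernel_op (K (Suc s)) ?g x\<bar>)
      \<le> mean (\<pi> (Suc s)) (\<lambda>x. \<bar>kernel_op (K (Suc s)) ?g x\<bar>)"
    by (intro mean_mono_measure pi_Suc) simp
  also have "\<dots> \<le> mean (\<pi> (Suc s)) (\<lambda>x. \<bar>?g x\<bar>)"
    by (intro mean_abs_kernel_op_le markov pi_invariant pi_nonneg) auto
  finally show ?case using step by (simp add: kernel_evolution_step)
qed

lemma evolution_1_2:
  assumes f: "mean (\<pi> t) (\<lambda>x. \<bar>f x\<bar>) \<le> 1" and "r \<le> t" "real t \<le> T"
  shows "mean (\<pi> r) (\<lambda>x. (kernel_evolution K r t f x)\<^sup>2)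
    \<le> (2 * (rate / (real (t - r) + 1)) powr D)\<^sup>2"
proof -
  \<comment> \<open>The index counts steps backwards from \<open>t\<close>. The next operator
    preserves the measure carrying \<open>v n\<close>, and the passage to the earlier, smaller
    measure only lowers \<open>v (Suc n)\<close>.\<close>
  define v where "v n = mean (\<pi> (t - n)) (\<lambda>x. (kernel_evolution K (t - n) t f x)\<^sup>2)" for n
  have "v (t - r) \<le> 4 * (C * (1 + 1 / T) * (1 + real_of_int \<lceil>2 * (2 * D)\<rceil>)
      / (real (t - r) + 1)) powr (2 * D)"
  proof (rule nash_sequence_decay[OF _ C _ T])
    show "v n \<ge> 0" for n unfolding v_def by (intro mean_nonneg pi_nonneg) simp
    show "v 0 powr (1 / (2 * D)) \<le> C * (1 + 1 / T)"
      using nash_initial[OF f] by (simp add: v_def)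
    show "v n powr (1 + 1 / (2 * D)) \<le> C * (v n - v (Suc n) + v n / T)" if n: "n < t - r" for n
    proof -
      obtain s where s: "t - n = Suc s" "t - Suc n = s" "s < t" using n by (cases "t - n") auto
      let ?g = "kernel_evolution K (Suc s) t f"
      have "v n powr (1 + 1 / (2 * D))
          \<le> C * (v n - mean (\<pi> (Suc s)) (\<lambda>x. (kernel_op (K (Suc s)) ?g x)\<^sup>2) + v n / T)"
        using nash_step[of "Suc s" ?g] evolution_mean_abs_le[OF f, of "Suc s"] s
        by (simp add: v_def)
      also have "\<dots> \<le> C * (v n - v (Suc n) + v n / T)"
      proof -
        have "v (Suc n) \<le> mean (\<pi> (Suc s)) (\<lambda>x. (kernel_op (K (Suc s)) ?g x)\<^sup>2)"
          unfolding v_def s(2) kernel_evolution_step[OF s(3)]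
          by (intro mean_mono_measure pi_Suc) simp
        then show ?thesis using C by (intro mult_left_mono) auto
      qed
      finally show ?thesis .
    qed
  qed (use D assms in auto)
  also have "\<dots> = 4 * (rate / (real (t - r) + 1)) powr (2 * D)" by (simp add: rate_def)
  also have "\<dots> = (2 * (rate / (real (t - r) + 1)) powr D)\<^sup>2"
    by (simp add: power_mult_distrib powr_powr[symmetric] powr_power mult.commute)
  finally show ?thesis using \<open>r \<le> t\<close> by (simp add: v_def)
qed

text \<open>By Jensen, the bound \<open>a\<close> from \<open>\<ell>\<^sup>1(\<pi>\<^sub>t)\<close> to \<open>\<ell>\<^sup>2(\<pi>\<^sub>s)\<close> gives
  \<open>\<parallel>K\<^sub>s\<^sub>,\<^sub>t\<parallel>\<^sub>2\<^sub>\<rightarrow>\<^sub>4 \<le> sqrt a\<close>, and similarly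
  \<open>\<parallel>K\<^sub>r\<^sub>,\<^sub>s\<parallel>\<^sub>4\<^sub>\<rightarrow>\<^sub>\<infinity> \<le> sqrt \<parallel>K\<^sub>r\<^sub>,\<^sub>s\<parallel>\<^sub>2\<^sub>\<rightarrow>\<^sub>\<infinity>\<close>.
  Splitting \<open>[r, t]\<close> at its midpoint closes an induction on the length.\<close>

lemma evolution_2_inf:
  assumes "mean (\<pi> t) (\<lambda>x. (f x)\<^sup>2) \<le> 1" "r \<le> t" "real t \<le> T"
  shows "\<bar>kernel_evolution K r t f x\<bar> \<le> 2 * (4 * rate / (real (t - r) + 1)) powr D"
  using assms
proof (induction "t - r" arbitrary: t f x rule: less_induct)
  case less
  note f = less.prems(1)
  show ?case
  proof (cases "r = t")
    case True
    \<comment> \<open>The point mass at \<open>x\<close> with ell^1 norm 1 has squared ell^2 norm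
      \<open>1 / \<pi> t x\<close>. The bound from ell^1 to ell^2 over zero steps thus keeps
      \<open>\<pi> t x\<close> away from 0, and
      \<open>(f x)\<^sup>2 * \<pi> t x \<le> 1\<close>.\<close>
    let ?d = "\<lambda>y. if y = x then 1 / \<pi> t x else 0"
    have d: "mean (\<pi> t) (\<lambda>y. if y = x then c else 0) = c * \<pi> t x" for c
      unfolding mean_def by (subst sum.cong[OF refl, of _ _ "\<lambda>y. if y = x then c * \<pi> t x else 0"]) auto
    have px: "\<pi> t x > 0" by (rule pi_pos)
    have "mean (\<pi> t) (\<lambda>y. \<bar>?d y\<bar>) = 1"
      using d[of "1 / \<pi> t x"] px by (simp add: if_distrib[of abs] cong: if_cong)
    then have "mean (\<pi> t) (\<lambda>y. (?d y)\<^sup>2) \<le> (2 * rate powr D)\<^sup>2"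
      using evolution_1_2[of t ?d t] less.prems by simp
    then have pi: "1 / \<pi> t x \<le> (2 * rate powr D)\<^sup>2"
      using d[of "(1 / \<pi> t x)\<^sup>2"] px
      unfolding if_distrib[of "\<lambda>z. z\<^sup>2"] by (simp add: power2_eq_square cong: if_cong)
    have "(f x)\<^sup>2 * \<pi> t x \<le> mean (\<pi> t) (\<lambda>y. (f y)\<^sup>2)"
      unfolding mean_def by (rule member_le_sum) (auto simp: pi_nonneg)
    with f have "(f x)\<^sup>2 \<le> 1 / \<pi> t x" using px by (simp add: field_simps)
    with pi have "\<bar>f x\<bar>\<^sup>2 \<le> (2 * rate powr D)\<^sup>2" by simp
    then have "\<bar>f x\<bar> \<le> 2 * rate powr D" by (rule power2_le_imp_le) simp
    also have "\<dots> \<le> 2 * (4 * rate) powr D"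
      using rate_pos D by (intro mult_left_mono powr_mono2) auto
    finally show ?thesis using True by simp
  next
    case False
    define n where "n = t - r"
    \<comment> \<open>Rounding up gives \<open>m \<ge> 1\<close>, so the block from \<open>r\<close>
      to \<open>s\<close> is strictly shorter and the induction hypothesis applies to it.\<close>
    define m where "m = (n + 1) div 2"
    define s where "s = t - m"
    have n: "n \<ge> 1" "m \<ge> 1" "m \<le> n" and nr: "t = r + n"
      using False less.prems by (auto simp: n_def m_def)
    then have s: "r \<le> s" "s \<le> t" "t - s = m" "s - r = n - m" "s < t"
      by (auto simp: s_def)
    define a where "a = 2 * (rate / (real m + 1)) powr D"
    define b where "b = 2 * (4 * rate / (real (n - m) + 1)) powr D"
    have a: "a > 0" and b: "b \<ge> 0" using rate_pos by (auto simp: a_def b_def)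
    define g where "g = kernel_evolution K s t f"
    obtain P where P: "markov_kernel P" "kernel_evolution K s t = kernel_op P"
      using kernel_evolution_markov[of K s t] markov s(2) by auto
    obtain R where R: "markov_kernel R" "kernel_evolution K r s = kernel_op R"
      using kernel_evolution_markov[of K r s] markov s(1) by auto
    \<comment> \<open>Dividing by \<open>a\<close> puts the square of \<open>g\<close> into the unit
      ball of ell^2 for \<open>\<pi> s\<close>, as the induction hypothesis with end time
      \<open>s\<close> requires.\<close>
    define h where "h y = (1 / a) * (g y)\<^sup>2" for y
    have "mean (\<pi> s) (\<lambda>y. ((g y)\<^sup>2)\<^sup>2) \<le> mean (\<pi> s) (\<lambda>y. (kernel_evolution K s t (\<lambda>y. (f y)\<^sup>2) y)\<^sup>2)"
      unfolding g_def P(2) by (intro mean_mono pi_nonneg power_mono kernel_op_square_le P) simp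
    also have "\<dots> \<le> a\<^sup>2"
      using evolution_1_2[of t "\<lambda>y. (f y)\<^sup>2" s] f s less.prems by (simp add: a_def)
    finally have "mean (\<pi> s) (\<lambda>y. (h y)\<^sup>2) \<le> 1"
      using a mean_cmult[of "\<pi> s" "(1 / a)\<^sup>2" "\<lambda>y. ((g y)\<^sup>2)\<^sup>2"]
      by (simp add: h_def power_mult_distrib power_divide)
    then have "\<bar>kernel_op R h x\<bar> \<le> b"
      using less.hyps[of s h x] s n less.prems(3) by (simp add: n_def R b_def)
    moreover have "kernel_op R (\<lambda>y. (g y)\<^sup>2) x = a * kernel_op R h x"
      using a unfolding h_def kernel_op_cmult by simp
    ultimately have "kernel_op R (\<lambda>y. (g y)\<^sup>2) x \<le> a * b" using a by simp
    then have "\<bar>kernel_op R g x\<bar>\<^sup>2 \<le> a * b"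
      using kernel_op_square_le[OF R(1), of g x] by simp
    also have "\<dots> = 4 * (rate / (real m + 1) * (4 * rate / (real (n - m) + 1))) powr D"
      using rate_pos by (simp add: a_def b_def powr_mult powr_divide)
    \<comment> \<open>The constants reproduce themselves: splitting at the midpoint loses a factor
      4, so a base \<open>c\<close> must satisfy \<open>4 * rate * c = c\<^sup>2\<close>, that is
      \<open>c = 4 * rate\<close>; the prefactors give \<open>2 * 2 = 2\<^sup>2\<close>.\<close>
    also have "\<dots> \<le> 4 * ((4 * rate / (real n + 1))\<^sup>2) powr D"
    proof (intro mult_left_mono powr_mono2)
      have "(n + 1)\<^sup>2 \<le> 4 * ((m + 1) * (n - m + 1))"
      proof (cases "even n")
        case True
        then obtain k where "n = 2 * k" by blast
        then show ?thesis by (simp add: m_def power2_eq_square algebra_simps)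
      next
        case False
        then obtain k where "n = 2 * k + 1" by (elim oddE)
        then show ?thesis by (simp add: m_def power2_eq_square algebra_simps)
      qed
      then have "real ((n + 1)\<^sup>2) \<le> real (4 * ((m + 1) * (n - m + 1)))"
        by (simp only: of_nat_le_iff)
      then have le: "(real n + 1)\<^sup>2 \<le> 4 * ((real m + 1) * (real (n - m) + 1))"
        by (simp only: of_nat_mult of_nat_power of_nat_add of_nat_1 of_nat_numeral)
      have "rate / (real m + 1) * (4 * rate / (real (n - m) + 1))
          = 16 * rate\<^sup>2 / (4 * ((real m + 1) * (real (n - m) + 1)))"
        by (simp add: power2_eq_square)
      also have "\<dots> \<le> 16 * rate\<^sup>2 / (real n + 1)\<^sup>2"
        using le by (intro divide_left_mono) (auto intro!: mult_pos_pos)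
      finally show "rate / (real m + 1) * (4 * rate / (real (n - m) + 1)) \<le> (4 * rate / (real n + 1))\<^sup>2"
        by (simp add: power_divide power_mult_distrib)
    qed (use D rate_pos in auto)
    also have "\<dots> = (2 * (4 * rate / (real n + 1)) powr D)\<^sup>2"
    proof -
      have "(w\<^sup>2) powr D = (w powr D)\<^sup>2" if "w \<ge> 0" for w :: real
        using that by (simp add: power2_eq_square powr_mult)
      from this[of "4 * rate / (real n + 1)"] rate_pos show ?thesis
        by (simp only: power_mult_distrib) simp
    qed
    finally have "\<bar>kernel_op R g x\<bar> \<le> 2 * (4 * rate / (real n + 1)) powr D"
      by (rule power2_le_imp_le) simp
    then show ?thesis
      using kernel_evolution_compose[OF s(1,2), of K f] by (simp add: R n_def g_def)
  qed
qed

lemma evolution_cmult: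
  assumes "r \<le> t"
  shows "kernel_evolution K r t (\<lambda>y. c * f y) x = c * kernel_evolution K r t f x"
proof -
  obtain P where "kernel_evolution K r t = kernel_op P"
    using kernel_evolution_markov[of K r t] markov assms by auto
  then show ?thesis by (simp add: kernel_op_cmult)
qed

end

section \<open>Centring and operator norms\<close>

text \<open>The variance is the second moment minus the squared mean, so centring costs nothing in
  ell^2.\<close>

lemma mean_centred_square_le:
  fixes \<mu> :: "'v::finite \<Rightarrow> real"
  assumes "(\<Sum>x\<in>UNIV. \<mu> x) = 1"
  shows "mean \<mu> (\<lambda>x. (g x - mean \<mu> g)\<^sup>2) \<le> mean \<mu> (\<lambda>x. (g x)\<^sup>2)"
proof -
  define m where "m = mean \<mu> g"
  have "mean \<mu> (\<lambda>x. (g x - m)\<^sup>2) = (\<Sum>x\<in>UNIV. (g x)\<^sup>2 * \<mu> x - 2 * m * (g x * \<mu> x) + m\<^sup>2 * \<mu> x)"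
    unfolding mean_def by (intro sum.cong refl) (simp add: power2_eq_square algebra_simps)
  also have "\<dots> = mean \<mu> (\<lambda>x. (g x)\<^sup>2) - 2 * m * m + m\<^sup>2"
    by (simp add: sum.distrib sum_subtractf sum_distrib_left[symmetric] assms mean_def m_def)
  finally show ?thesis by (simp add: m_def power2_eq_square)
qed

text \<open>The zero function makes the unit ball nonempty, as a real supremum requires.\<close>

lemma op_norm_le:
  assumes "\<And>f. M f \<le> 1 \<Longrightarrow> N (A f) \<le> B" "M (\<lambda>_. 0) \<le> 1"
  shows "op_norm M N A \<le> B"
  unfolding op_norm_def using assms by (intro cSUP_least) auto

theorem theorem3p11:
  fixes K :: "nat \<Rightarrow> 'v::finite \<Rightarrow> 'v \<Rightarrow> real"
    and \<pi> :: "nat \<Rightarrow> 'v \<Rightarrow> real"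
    and C D T :: real
  assumes "\<And>t. t \<ge> 1 \<Longrightarrow> markov_kernel (K t)"
    and "\<And>t. t \<ge> 1 \<Longrightarrow> irreducible_kernel (K t)"
    and "\<And>t. t \<ge> 1 \<Longrightarrow> aperiodic_kernel (K t)"
    and "finite_nondecreasing_environment K \<pi>"
    and pi_0: "\<pi> 0 = \<pi> 1"
    and "T \<ge> 1" and "C > 0" and "D > 0"
    and "\<And>t. t \<ge> 1 \<Longrightarrow>
           nash_inequality C D T
             (ell2_adjoint (normalized (\<pi> t)) (kernel_op (K t)) \<circ> kernel_op (K t))
             (normalized (\<pi> t))"
    and "mass (\<pi> 1) \<ge> 1"
  shows "\<forall>r t :: nat. r \<le> t \<and> real t \<le> T \<longrightarrow>
      op_norm (ell_norm 1 (normalized (\<pi> t))) (ell_norm 2 (normalized (\<pi> r)))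
          (centred_op (normalized (\<pi> r)) (kernel_evolution K r t))
        \<le> (C * 2 powr (1 / D) * (1 + 1 / T) * (1 + real_of_int \<lceil>4 * D\<rceil>)
             / (real t - real r + 1)) powr D
           * (mass (\<pi> t) / sqrt (mass (\<pi> r)))
      \<and>
      op_norm (ell_norm 2 (normalized (\<pi> t))) ell_inf_norm
          (centred_op (normalized (\<pi> r)) (kernel_evolution K r t))
        \<le> 2 * (4 * C * 2 powr (1 / D) * (1 + 1 / T) * (1 + real_of_int \<lceil>4 * D\<rceil>)
             / (real t - real r + 1)) powr D
           * sqrt (mass (\<pi> t))"
proof (intro allI impI, elim conjE)
  fix r t :: nat
  assume rt: "r \<le> t" "real t \<le> T"
  interpret nash_environment K \<pi> C D T
    using assms by unfold_locales auto
  let ?G = "kernel_evolution K r t" and ?\<nu> = "normalized (\<pi> r)"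
  define mt where "mt = mass (\<pi> t)"
  define mr where "mr = mass (\<pi> r)"
  have mt: "mt > 0" and mr: "mr > 0" using mass_pos[of "\<pi> t"] mass_pos[of "\<pi> r"] pi_pos by (auto simp: mt_def mr_def)
  have nn: "normalized (\<pi> s) x \<ge> 0" for s x
    using normalized_pos[of "\<pi> s" x] pi_pos by (simp add: less_imp_le)
  have prob: "(\<Sum>x\<in>UNIV. ?\<nu> x) = 1" using sum_normalized[of "\<pi> r"] pi_pos by simp
  have two: "2 * y powr D = (y * 2 powr (1 / D)) powr D" if "y \<ge> 0" for y :: real
    using that D by (simp add: powr_mult powr_powr)
  have len: "real t - real r + 1 = real (t - r) + 1" using rt by simp
  define n where "n = real (t - r) + 1"
  have n: "n > 0" by (simp add: n_def)
  have "op_norm (ell_norm 1 (normalized (\<pi> t))) (ell_norm 2 ?\<nu>) (centred_op ?\<nu> ?G)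
      \<le> 2 * (rate / n) powr D * (mt / sqrt mr)"
  proof (rule op_norm_le)
    fix f assume "ell_norm 1 (normalized (\<pi> t)) f \<le> 1"
    \<comment> \<open>Dividing \<open>f\<close> by \<open>mt\<close> turns the normalized unit ball
      into the unnormalized one. Scaling back gives the factor \<open>mt\<close>, and normalizing
      \<open>\<pi> r\<close> gives \<open>1 / sqrt mr\<close>.\<close>
    then have "mean (\<pi> t) (\<lambda>x. \<bar>1 / mt * f x\<bar>) \<le> 1"
      using mean_cmult[of "\<pi> t" "1 / mt" "\<lambda>x. \<bar>f x\<bar>"] mt
      by (simp add: ell_norm_1 nn mean_normalized mt_def abs_mult)
    then have "mean (\<pi> r) (\<lambda>x. (?G (\<lambda>x. 1 / mt * f x) x)\<^sup>2) \<le> (2 * (rate / n) powr D)\<^sup>2"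
      unfolding n_def by (rule evolution_1_2[OF _ rt])
    then have "mean (\<pi> r) (\<lambda>x. (1 / mt)\<^sup>2 * (?G f x)\<^sup>2) \<le> (2 * (rate / n) powr D)\<^sup>2"
      unfolding evolution_cmult[OF rt(1)] by (simp only: power_mult_distrib)
    then have "mean (\<pi> r) (\<lambda>x. (?G f x)\<^sup>2) \<le> (2 * (rate / n) powr D * mt)\<^sup>2"
      unfolding mean_cmult using mt by (simp add: power_mult_distrib power_divide field_simps)
    then have "mean ?\<nu> (\<lambda>x. (?G f x)\<^sup>2) \<le> (2 * (rate / n) powr D * mt)\<^sup>2 / mr"
      unfolding mean_normalized mr_def[symmetric] using mr by (intro divide_right_mono) auto
    with mean_centred_square_le[OF prob, of "?G f"]
    have "mean ?\<nu> (\<lambda>x. (centred_op ?\<nu> ?G f x)\<^sup>2) \<le> (2 * (rate / n) powr D * mt)\<^sup>2 / mr"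
      by (simp add: centred_op_def)
    then have "sqrt (mean ?\<nu> (\<lambda>x. (centred_op ?\<nu> ?G f x)\<^sup>2))
        \<le> sqrt ((2 * (rate / n) powr D * mt)\<^sup>2 / mr)" by simp
    also have "\<dots> = 2 * (rate / n) powr D * (mt / sqrt mr)"
      using mt by (simp add: real_sqrt_divide)
    finally show "ell_norm 2 ?\<nu> (centred_op ?\<nu> ?G f) \<le> 2 * (rate / n) powr D * (mt / sqrt mr)"
      by (simp add: ell_norm_2 nn)
  qed (simp add: ell_norm_def)
  moreover have "2 * (rate / n) powr D = (C * 2 powr (1 / D) * (1 + 1 / T)
      * (1 + real_of_int \<lceil>4 * D\<rceil>) / n) powr D"
    using rate_pos n by (subst two) (simp_all add: rate_def mult_ac)
  moreover have "op_norm (ell_norm 2 (normalized (\<pi> t))) ell_inf_norm (centred_op ?\<nu> ?G)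
      \<le> 2 * (2 * (4 * rate / n) powr D) * sqrt mt"
  proof (rule op_norm_le)
    fix f assume "ell_norm 2 (normalized (\<pi> t)) f \<le> 1"
    then have "mean (\<pi> t) (\<lambda>x. (1 / sqrt mt * f x)\<^sup>2) \<le> 1"
      using mean_cmult[of "\<pi> t" "1 / mt" "\<lambda>x. (f x)\<^sup>2"] mt
      by (simp add: ell_norm_2 nn mean_normalized mt_def power_mult_distrib power_divide)
    then have "\<bar>?G (\<lambda>x. 1 / sqrt mt * f x) x\<bar> \<le> 2 * (4 * rate / n) powr D" for x
      unfolding n_def by (rule evolution_2_inf[OF _ rt])
    then have G: "\<bar>?G f x\<bar> \<le> 2 * (4 * rate / n) powr D * sqrt mt" (is "_ \<le> ?B") for x
      unfolding evolution_cmult[OF rt(1)] using mt by (simp add: abs_mult field_simps)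
    \<comment> \<open>In the supremum norm centring at most doubles the bound, hence the 2 in front
      of the second estimate.\<close>
    have "\<bar>mean ?\<nu> (?G f)\<bar> \<le> mean ?\<nu> (\<lambda>x. \<bar>?G f x\<bar>)"
      unfolding mean_def using sum_abs[of "\<lambda>x. ?G f x * ?\<nu> x" UNIV] nn by (simp add: abs_mult)
    also have "\<dots> \<le> mean ?\<nu> (\<lambda>x. ?B)" by (intro mean_mono nn G)
    also have "\<dots> = ?B" by (simp add: mean_def sum_distrib_left[symmetric] prob)
    finally have "\<bar>centred_op ?\<nu> ?G f x\<bar> \<le> 2 * ?B" for x
      using G[of x] unfolding centred_op_def by linarith
    then show "ell_inf_norm (centred_op ?\<nu> ?G f) \<le> 2 * (2 * (4 * rate / n) powr D) * sqrt mt"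
      unfolding ell_inf_norm_def by (intro cSUP_least) (auto simp: mult_ac)
  qed (simp add: ell_norm_def)
  moreover have "2 * (4 * rate / n) powr D = (4 * C * 2 powr (1 / D) * (1 + 1 / T)
      * (1 + real_of_int \<lceil>4 * D\<rceil>) / n) powr D"
    using rate_pos n by (subst two) (simp_all add: rate_def mult_ac)
  ultimately show "op_norm (ell_norm 1 (normalized (\<pi> t))) (ell_norm 2 (normalized (\<pi> r)))
          (centred_op (normalized (\<pi> r)) (kernel_evolution K r t))
        \<le> (C * 2 powr (1 / D) * (1 + 1 / T) * (1 + real_of_int \<lceil>4 * D\<rceil>)
             / (real t - real r + 1)) powr D
           * (mass (\<pi> t) / sqrt (mass (\<pi> r)))
      \<and>
      op_norm (ell_norm 2 (normalized (\<pi> t))) ell_inf_norm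
          (centred_op (normalized (\<pi> r)) (kernel_evolution K r t))
        \<le> 2 * (4 * C * 2 powr (1 / D) * (1 + 1 / T) * (1 + real_of_int \<lceil>4 * D\<rceil>)
             / (real t - real r + 1)) powr D
           * sqrt (mass (\<pi> t))"
    unfolding len mt_def mr_def n_def by simp
qed

end
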